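(* The Gentzen calculus $\mathcal G_{\mathcal{LB}}$ is algebraizable with respect to the variety $\mathsf{DBiLat}$ of distributive bilattices, with the following translations: $$\tau(\Gamma\rhd\Delta)=\{\bigwedge\Gamma\land(\bigwedge\Gamma\otimes\bigvee\Delta)\approx\bigwedge\Gamma\},$$ $$\rho(\varphi\approx\psi)=\{\varphi\rhd\psi,\ \neg\varphi\rhd\neg\psi,\ \psi\rhd\varphi,\ \neg\psi\rhd\neg\varphi\}.$$
   Context: A bilattice is an algebra $\langle B,\land,\lor,\otimes,\oplus,\neg\rangle$ such that $\langle B,\land,\lor\rangle$ and $\langle B,\otimes,\oplus\rangle$ are lattices (not necessarily bounded) with associated orders $\leq_t$ and $\leq_k$, and $\neg$ is a unary operation such that for all $a,b$: $a\leq_t b$ implies $\neg b\leq_t\neg a$; $a\leq_k b$ implies $\neg a\leq_k\neg b$; $\neg\neg a=a$. It is distributive if $x\circ(y\bullet z)\approx(x\circ y)\bullet(x\circ z)$ holds for all distinct $\circ,\bullet\in\{\land,\lor,\otimes,\oplus\}$. Formulas are built from a countable set of variables in the language $\{\land,\lor,\otimes,\oplus,\neg\}$. A sequent $\Gamma\rhd\Delta$ is a pair of finite non-empty sets of formulas. $\bigwedge\Gamma$ and $\bigvee\Delta$ denote the conjunction ($\land$) and disjunction ($\lor$) of the members of the set (in some fixed order and bracketing). The calculus $\mathcal G_{\mathcal{LB}}$ has the axiom $\Gamma,\varphi\rhd\varphi,\Delta$, the Cut rule (from $\Gamma\rhd\Delta,\varphi$ and $\Gamma,\varphi\rhd\Delta$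 infer $\Gamma\rhd\Delta$, and, more generally, from $\Gamma\rhd\Delta,\varphi$ and $\Gamma',\varphi\rhd\Delta'$ infer $\Gamma,\Gamma'\rhd\Delta,\Delta'$), and the following logical rules (here $\Gamma,\Delta$ may be empty as long as the sequents involved have both sides non-empty): - $(\land\rhd)$ from $\Gamma,\varphi,\psi\rhd\Delta$ infer $\Gamma,\varphi\land\psi\rhd\Delta$; $(\rhd\land)$ from $\Gamma\rhd\Delta,\varphi$ and $\Gamma\rhd\Delta,\psi$ infer $\Gamma\rhd\Delta,\varphi\land\psi$; - $(\neg\land\rhd)$ from $\Gamma,\neg\varphi\rhd\Delta$ and $\Gamma,\neg\psi\rhd\Delta$ infer $\Gamma,\neg(\varphi\land\psi)\rhd\Delta$; $(\rhd\neg\land)$ from $\Gamma\rhd\Delta,\neg\varphi,\neg\psi$ infer $\Gamma\rhd\Delta,\neg(\varphi\land\psi)$; - $(\lor\rhd)$ from $\Gamma,\varphi\rhd\Delta$ and $\Gamma,\psi\rhd\Delta$ infer $\Gamma,\varphi\lor\psi\rhd\Delta$; $(\rhd\lor)$ from $\Gamma\rhd\Delta,\varphi,\psi$ infer $\Gamma\rhd\Delta,\varphi\lor\psi$; - $(\neg\lor\rhd)$ from $\Gamma,\neg\varphi,\neg\psi\rhd\Delta$ infer $\Gamma,\neg(\varphi\lor\psi)\rhd\Delta$; $(\rhd\neg\lor)$ from $\Gamma\rhd\Delta,\neg\varphi$ and $\Gamma\rhd\Delta,\neg\psi$ infer $\Gamma\rhd\Delta,\neg(\varphi\lor\psi)$;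 - $(\otimes\rhd)$ from $\Gamma,\varphi,\psi\rhd\Delta$ infer $\Gamma,\varphi\otimes\psi\rhd\Delta$; $(\rhd\otimes)$ from $\Gamma\rhd\Delta,\varphi$ and $\Gamma\rhd\Delta,\psi$ infer $\Gamma\rhd\Delta,\varphi\otimes\psi$; - $(\neg\otimes\rhd)$ from $\Gamma,\neg\varphi,\neg\psi\rhd\Delta$ infer $\Gamma,\neg(\varphi\otimes\psi)\rhd\Delta$; $(\rhd\neg\otimes)$ from $\Gamma\rhd\Delta,\neg\varphi$ and $\Gamma\rhd\Delta,\neg\psi$ infer $\Gamma\rhd\Delta,\neg(\varphi\otimes\psi)$; - $(\oplus\rhd)$ from $\Gamma,\varphi\rhd\Delta$ and $\Gamma,\psi\rhd\Delta$ infer $\Gamma,\varphi\oplus\psi\rhd\Delta$; $(\rhd\oplus)$ from $\Gamma\rhd\Delta,\varphi,\psi$ infer $\Gamma\rhd\Delta,\varphi\oplus\psi$; - $(\neg\oplus\rhd)$ from $\Gamma,\neg\varphi\rhd\Delta$ and $\Gamma,\neg\psi\rhd\Delta$ infer $\Gamma,\neg(\varphi\oplus\psi)\rhd\Delta$; $(\rhd\neg\oplus)$ from $\Gamma\rhd\Delta,\neg\varphi,\neg\psi$ infer $\Gamma\rhd\Delta,\neg(\varphi\oplus\psi)$; - $(\neg\neg\rhd)$ from $\Gamma,\varphi\rhd\Delta$ infer $\Gamma,\neg\neg\varphi\rhd\Delta$; $(\rhd\neg\neg)$ from $\Gamma\rhd\Delta,\varphi$ infer $\Gamma\rhd\Delta,\neg\neg\varphi$.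 For a set $S$ of sequents and a sequent $s$, write $S\mathrel{|\!\sim} s$ if $s$ is derivable from the members of $S$ and axioms by finitely many applications of the rules. For a class $\mathsf K$ of algebras, $\models_{\mathsf K}$ is the equational consequence relation of $\mathsf K$. Algebraizability of $\mathcal G_{\mathcal{LB}}$ with respect to $\mathsf K$ with translations $\tau$ (sequents to finite sets of equations) and $\rho$ (equations to finite sets of sequents) means: (1) for every set $S\cup\{s\}$ of sequents, $S\mathrel{|\!\sim}s$ iff $\bigcup_{s'\in S}\tau(s')\models_{\mathsf K}\tau(s)$; and (2) for every equation $\varphi\approx\psi$, the sets $\{\varphi\approx\psi\}$ and $\bigcup\{\tau(s): s\in\rho(\varphi\approx\psi)\}$ are interderivable with respect to $\models_{\mathsf K}$. *)

theory Defs
  imports Main "HOL-Library.Countable"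
begin

datatype conn = Conj | Disj | Otimes | Oplus

datatype 'v fm = Var 'v | Neg "'v fm" | Bin conn "'v fm" "'v fm"

abbreviation neg_fm ("\<^bold>\<not> _" [80] 80) where "\<^bold>\<not> \<phi> \<equiv> Neg \<phi>"
abbreviation conj_fm (infixr "\<^bold>\<and>" 75) where "\<phi> \<^bold>\<and> \<psi> \<equiv> Bin Conj \<phi> \<psi>"
abbreviation disj_fm (infixr "\<^bold>\<or>" 75) where "\<phi> \<^bold>\<or> \<psi> \<equiv> Bin Disj \<phi> \<psi>"
abbreviation otimes_fm (infixr "\<^bold>\<otimes>" 75) where "\<phi> \<^bold>\<otimes> \<psi> \<equiv> Bin Otimes \<phi> \<psi>"
abbreviation oplus_fm (infixr "\<^bold>\<oplus>" 75) where "\<phi> \<^bold>\<oplus> \<psi> \<equiv> Bin Oplus \<phi> \<psi>"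


record 'a alg =
  carrier :: "'a set"
  binop :: "conn \<Rightarrow> 'a \<Rightarrow> 'a \<Rightarrow> 'a"
  neg :: "'a \<Rightarrow> 'a"

definition closed_alg :: "'a alg \<Rightarrow> bool" where
  "closed_alg B \<longleftrightarrow> carrier B \<noteq> {} \<and>
     (\<forall>c. \<forall>x\<in>carrier B. \<forall>y\<in>carrier B. binop B c x y \<in> carrier B) \<and>
     (\<forall>x\<in>carrier B. neg B x \<in> carrier B)"

definition lattice_on :: "'a set \<Rightarrow> ('a \<Rightarrow> 'a \<Rightarrow> 'a) \<Rightarrow> ('a \<Rightarrow> 'a \<Rightarrow> 'a) \<Rightarrow> bool" where
  "lattice_on A m j \<longleftrightarrow>
     (\<forall>x\<in>A. \<forall>y\<in>A. m x y \<in> A \<and> j x y \<in> A) \<and>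
     (\<forall>x\<in>A. \<forall>y\<in>A. m x y = m y x \<and> j x y = j y x) \<and>
     (\<forall>x\<in>A. \<forall>y\<in>A. \<forall>z\<in>A. m (m x y) z = m x (m y z) \<and> j (j x y) z = j x (j y z)) \<and>
     (\<forall>x\<in>A. \<forall>y\<in>A. m x (j x y) = x \<and> j x (m x y) = x)"

definition le_t :: "'a alg \<Rightarrow> 'a \<Rightarrow> 'a \<Rightarrow> bool" where
  "le_t B a b \<longleftrightarrow> binop B Conj a b = a"

definition le_k :: "'a alg \<Rightarrow> 'a \<Rightarrow> 'a \<Rightarrow> bool" where
  "le_k B a b \<longleftrightarrow> binop B Otimes a b = a"

definition bilattice :: "'a alg \<Rightarrow> bool" where
  "bilattice B \<longleftrightarrow> closed_alg B \<and>
     lattice_on (carrier B) (binop B Conj) (binop B Disj) \<and>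
     lattice_on (carrier B) (binop B Otimes) (binop B Oplus) \<and>
     (\<forall>a\<in>carrier B. \<forall>b\<in>carrier B. le_t B a b \<longrightarrow> le_t B (neg B b) (neg B a)) \<and>
     (\<forall>a\<in>carrier B. \<forall>b\<in>carrier B. le_k B a b \<longrightarrow> le_k B (neg B a) (neg B b)) \<and>
     (\<forall>a\<in>carrier B. neg B (neg B a) = a)"

definition distributive :: "'a alg \<Rightarrow> bool" where
  "distributive B \<longleftrightarrow>
     (\<forall>c d. c \<noteq> d \<longrightarrow>
       (\<forall>x\<in>carrier B. \<forall>y\<in>carrier B. \<forall>z\<in>carrier B.
          binop B c x (binop B d y z) = binop B d (binop B c x y) (binop B c x z)))"

definition DBiLat :: "'a alg set" where
  "DBiLat = {B. bilattice B \<and> distributive B}"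


type_synonym 'v eqn = "'v fm \<times> 'v fm"

abbreviation eqn (infix "\<^bold>\<approx>" 55) where "\<phi> \<^bold>\<approx> \<psi> \<equiv> (\<phi>, \<psi>)"

primrec eval :: "'a alg \<Rightarrow> ('v \<Rightarrow> 'a) \<Rightarrow> 'v fm \<Rightarrow> 'a" where
  "eval B h (Var x) = h x"
| "eval B h (Neg \<phi>) = neg B (eval B h \<phi>)"
| "eval B h (Bin c \<phi> \<psi>) = binop B c (eval B h \<phi>) (eval B h \<psi>)"

definition sat :: "'a alg \<Rightarrow> ('v \<Rightarrow> 'a) \<Rightarrow> 'v eqn \<Rightarrow> bool" where
  "sat B h e \<longleftrightarrow> eval B h (fst e) = eval B h (snd e)"

definition eq_conseq :: "'a alg set \<Rightarrow> 'v eqn set \<Rightarrow> 'v eqn set \<Rightarrow> bool" where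
  "eq_conseq K E F \<longleftrightarrow>
     (\<forall>e\<in>F. \<forall>B\<in>K. \<forall>h. range h \<subseteq> carrier B \<longrightarrow> (\<forall>e'\<in>E. sat B h e') \<longrightarrow> sat B h e)"


type_synonym 'v seq = "'v fm set \<times> 'v fm set"

abbreviation seq (infix "\<rhd>" 50) where "\<Gamma> \<rhd> \<Delta> \<equiv> (\<Gamma>, \<Delta>)"

definition sequents :: "'v seq set" where
  "sequents = {(\<Gamma>, \<Delta>). finite \<Gamma> \<and> \<Gamma> \<noteq> {} \<and> finite \<Delta> \<and> \<Delta> \<noteq> {}}"

text \<open>
  The rules need no side conditions: if the premises are finite and non-empty on both sides,
  so is the conclusion (lemma \<open>derivable_sequents\<close> below). The additive form of Cut is the
  instance \<open>\<Gamma>' = \<Gamma>\<close>, \<open>\<Delta>' = \<Delta>\<close> of \<open>Cut\<close>.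
\<close>

inductive derivable :: "'v seq set \<Rightarrow> 'v seq \<Rightarrow> bool" for S :: "'v seq set" where
  Hyp: "s \<in> S \<Longrightarrow> derivable S s"
| Ax: "finite \<Gamma> \<Longrightarrow> finite \<Delta> \<Longrightarrow> derivable S (insert \<phi> \<Gamma> \<rhd> insert \<phi> \<Delta>)"
| Cut: "derivable S (\<Gamma> \<rhd> insert \<phi> \<Delta>) \<Longrightarrow> derivable S (insert \<phi> \<Gamma>' \<rhd> \<Delta>')
    \<Longrightarrow> derivable S (\<Gamma> \<union> \<Gamma>' \<rhd> \<Delta> \<union> \<Delta>')"
| ConjL: "derivable S (insert \<phi> (insert \<psi> \<Gamma>) \<rhd> \<Delta>)
    \<Longrightarrow> derivable S (insert (\<phi> \<^bold>\<and> \<psi>) \<Gamma> \<rhd> \<Delta>)"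
| ConjR: "derivable S (\<Gamma> \<rhd> insert \<phi> \<Delta>) \<Longrightarrow> derivable S (\<Gamma> \<rhd> insert \<psi> \<Delta>)
    \<Longrightarrow> derivable S (\<Gamma> \<rhd> insert (\<phi> \<^bold>\<and> \<psi>) \<Delta>)"
| NegConjL: "derivable S (insert (\<^bold>\<not> \<phi>) \<Gamma> \<rhd> \<Delta>) \<Longrightarrow> derivable S (insert (\<^bold>\<not> \<psi>) \<Gamma> \<rhd> \<Delta>)
    \<Longrightarrow> derivable S (insert (\<^bold>\<not> (\<phi> \<^bold>\<and> \<psi>)) \<Gamma> \<rhd> \<Delta>)"
| NegConjR: "derivable S (\<Gamma> \<rhd> insert (\<^bold>\<not> \<phi>) (insert (\<^bold>\<not> \<psi>) \<Delta>))
    \<Longrightarrow> derivable S (\<Gamma> \<rhd> insert (\<^bold>\<not> (\<phi> \<^bold>\<and> \<psi>)) \<Delta>)"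
| DisjL: "derivable S (insert \<phi> \<Gamma> \<rhd> \<Delta>) \<Longrightarrow> derivable S (insert \<psi> \<Gamma> \<rhd> \<Delta>)
    \<Longrightarrow> derivable S (insert (\<phi> \<^bold>\<or> \<psi>) \<Gamma> \<rhd> \<Delta>)"
| DisjR: "derivable S (\<Gamma> \<rhd> insert \<phi> (insert \<psi> \<Delta>))
    \<Longrightarrow> derivable S (\<Gamma> \<rhd> insert (\<phi> \<^bold>\<or> \<psi>) \<Delta>)"
| NegDisjL: "derivable S (insert (\<^bold>\<not> \<phi>) (insert (\<^bold>\<not> \<psi>) \<Gamma>) \<rhd> \<Delta>)
    \<Longrightarrow> derivable S (insert (\<^bold>\<not> (\<phi> \<^bold>\<or> \<psi>)) \<Gamma> \<rhd> \<Delta>)"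
| NegDisjR: "derivable S (\<Gamma> \<rhd> insert (\<^bold>\<not> \<phi>) \<Delta>) \<Longrightarrow> derivable S (\<Gamma> \<rhd> insert (\<^bold>\<not> \<psi>) \<Delta>)
    \<Longrightarrow> derivable S (\<Gamma> \<rhd> insert (\<^bold>\<not> (\<phi> \<^bold>\<or> \<psi>)) \<Delta>)"
| OtimesL: "derivable S (insert \<phi> (insert \<psi> \<Gamma>) \<rhd> \<Delta>)
    \<Longrightarrow> derivable S (insert (\<phi> \<^bold>\<otimes> \<psi>) \<Gamma> \<rhd> \<Delta>)"
| OtimesR: "derivable S (\<Gamma> \<rhd> insert \<phi> \<Delta>) \<Longrightarrow> derivable S (\<Gamma> \<rhd> insert \<psi> \<Delta>)
    \<Longrightarrow> derivable S (\<Gamma> \<rhd> insert (\<phi> \<^bold>\<otimes> \<psi>) \<Delta>)"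
| NegOtimesL: "derivable S (insert (\<^bold>\<not> \<phi>) (insert (\<^bold>\<not> \<psi>) \<Gamma>) \<rhd> \<Delta>)
    \<Longrightarrow> derivable S (insert (\<^bold>\<not> (\<phi> \<^bold>\<otimes> \<psi>)) \<Gamma> \<rhd> \<Delta>)"
| NegOtimesR: "derivable S (\<Gamma> \<rhd> insert (\<^bold>\<not> \<phi>) \<Delta>) \<Longrightarrow> derivable S (\<Gamma> \<rhd> insert (\<^bold>\<not> \<psi>) \<Delta>)
    \<Longrightarrow> derivable S (\<Gamma> \<rhd> insert (\<^bold>\<not> (\<phi> \<^bold>\<otimes> \<psi>)) \<Delta>)"
| OplusL: "derivable S (insert \<phi> \<Gamma> \<rhd> \<Delta>) \<Longrightarrow> derivable S (insert \<psi> \<Gamma> \<rhd> \<Delta>)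
    \<Longrightarrow> derivable S (insert (\<phi> \<^bold>\<oplus> \<psi>) \<Gamma> \<rhd> \<Delta>)"
| OplusR: "derivable S (\<Gamma> \<rhd> insert \<phi> (insert \<psi> \<Delta>))
    \<Longrightarrow> derivable S (\<Gamma> \<rhd> insert (\<phi> \<^bold>\<oplus> \<psi>) \<Delta>)"
| NegOplusL: "derivable S (insert (\<^bold>\<not> \<phi>) \<Gamma> \<rhd> \<Delta>) \<Longrightarrow> derivable S (insert (\<^bold>\<not> \<psi>) \<Gamma> \<rhd> \<Delta>)
    \<Longrightarrow> derivable S (insert (\<^bold>\<not> (\<phi> \<^bold>\<oplus> \<psi>)) \<Gamma> \<rhd> \<Delta>)"
| NegOplusR: "derivable S (\<Gamma> \<rhd> insert (\<^bold>\<not> \<phi>) (insert (\<^bold>\<not> \<psi>) \<Delta>))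
    \<Longrightarrow> derivable S (\<Gamma> \<rhd> insert (\<^bold>\<not> (\<phi> \<^bold>\<oplus> \<psi>)) \<Delta>)"
| NegNegL: "derivable S (insert \<phi> \<Gamma> \<rhd> \<Delta>) \<Longrightarrow> derivable S (insert (\<^bold>\<not> (\<^bold>\<not> \<phi>)) \<Gamma> \<rhd> \<Delta>)"
| NegNegR: "derivable S (\<Gamma> \<rhd> insert \<phi> \<Delta>) \<Longrightarrow> derivable S (\<Gamma> \<rhd> insert (\<^bold>\<not> (\<^bold>\<not> \<phi>)) \<Delta>)"

lemma derivable_sequents:
  assumes "derivable S s" "S \<subseteq> sequents"
  shows "s \<in> sequents"
  using assms by (induction rule: derivable.induct) (auto simp: sequents_def)


text \<open>
  \<open>combination c X \<phi>\<close> says that \<open>\<phi>\<close> combines the members of \<open>X\<close>, each used exactly once,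
  by the connective \<open>c\<close>, in some order and bracketing. A choice of order and bracketing is a
  function selecting such a \<open>\<phi>\<close> for every finite non-empty \<open>X\<close>.
\<close>

inductive combination :: "conn \<Rightarrow> 'v fm set \<Rightarrow> 'v fm \<Rightarrow> bool" for c :: conn where
  single: "combination c {\<phi>} \<phi>"
| join: "combination c X \<phi> \<Longrightarrow> combination c Y \<psi> \<Longrightarrow> X \<inter> Y = {}
    \<Longrightarrow> combination c (X \<union> Y) (Bin c \<phi> \<psi>)"

definition combination_choice :: "conn \<Rightarrow> ('v fm set \<Rightarrow> 'v fm) \<Rightarrow> bool" where
  "combination_choice c f \<longleftrightarrow> (\<forall>X. finite X \<longrightarrow> X \<noteq> {} \<longrightarrow> combination c X (f X))"

lemma combination_choice_exists: "\<exists>f :: 'v fm set \<Rightarrow> 'v fm. combination_choice c f"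
proof -
  have "\<exists>\<phi>. combination c X \<phi>" if "finite X" "X \<noteq> {}" for X :: "'v fm set"
    using that
  proof (induction X rule: finite_ne_induct)
    case (singleton x)
    then show ?case by (blast intro: single)
  next
    case (insert x F)
    then obtain \<psi> where "combination c F \<psi>" by blast
    then have "combination c ({x} \<union> F) (Bin c x \<psi>)"
      using insert.hyps by (intro join single) auto
    then show ?case by auto
  qed
  then show ?thesis unfolding combination_choice_def by metis
qed

definition tau :: "('v fm set \<Rightarrow> 'v fm) \<Rightarrow> ('v fm set \<Rightarrow> 'v fm) \<Rightarrow> 'v seq \<Rightarrow> 'v eqn set" where
  "tau bigconj bigdisj s = (case s of (\<Gamma>, \<Delta>) \<Rightarrow>
     {bigconj \<Gamma> \<^bold>\<and> (bigconj \<Gamma> \<^bold>\<otimes> bigdisj \<Delta>) \<^bold>\<approx> bigconj \<Gamma>})"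

definition rho :: "'v eqn \<Rightarrow> 'v seq set" where
  "rho e = (case e of (\<phi>, \<psi>) \<Rightarrow>
     {{\<phi>} \<rhd> {\<psi>}, {\<^bold>\<not> \<phi>} \<rhd> {\<^bold>\<not> \<psi>}, {\<psi>} \<rhd> {\<phi>}, {\<^bold>\<not> \<psi>} \<rhd> {\<^bold>\<not> \<phi>}})"

definition algebraizable ::
  "('v seq set \<Rightarrow> 'v seq \<Rightarrow> bool) \<Rightarrow> 'a alg set \<Rightarrow> ('v seq \<Rightarrow> 'v eqn set)
     \<Rightarrow> ('v eqn \<Rightarrow> 'v seq set) \<Rightarrow> bool" where
  "algebraizable D K \<tau> \<rho> \<longleftrightarrow>
     (\<forall>s\<in>sequents. finite (\<tau> s)) \<and>
     (\<forall>e. finite (\<rho> e) \<and> \<rho> e \<subseteq> sequents) \<and>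
     (\<forall>S s. S \<subseteq> sequents \<longrightarrow> s \<in> sequents \<longrightarrow>
        (D S s \<longleftrightarrow> eq_conseq K (\<Union>s'\<in>S. \<tau> s') (\<tau> s))) \<and>
     (\<forall>e. eq_conseq K {e} (\<Union>s\<in>\<rho> e. \<tau> s) \<and> eq_conseq K (\<Union>s\<in>\<rho> e. \<tau> s) {e})"

text \<open>
  HOL cannot quantify over all types inside a formula, so \<open>DBiLat :: 'a alg set\<close> consists of the
  distributive bilattices whose carrier is a (finite or infinite) subset of the type \<open>'a\<close>.
  If \<open>'a\<close> is an arbitrary infinite type, no generality is lost: every algebra is isomorphic to
  one of this form for some such \<open>'a\<close>. On a one-element type all equations would hold.
\<close>

end

theory Submission imports Defs begin

text \<open>
  In a distributive bilattice let \<open>a \<sqsubseteq> b\<close> mean \<open>a \<and> (a \<otimes> b) = a\<close>, which is the same as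
  \<open>a \<otimes> (a \<and> b) = a\<close>. This is a preorder for which \<open>\<and>\<close> and \<open>\<otimes>\<close> are both meets and
  \<open>\<or>\<close> and \<open>\<oplus>\<close> are both joins, and distributivity makes the rules of the calculus sound for it;
  moreover \<open>a \<sqsubseteq> b \<sqsubseteq> a\<close> and \<open>\<not> a \<sqsubseteq> \<not> b \<sqsubseteq> \<not> a\<close> together force \<open>a = b\<close>.

  For completeness, if \<open>S\<close> does not derive \<open>\<Gamma> \<rhd> \<Delta>\<close>, choose \<open>T \<supseteq> \<Gamma>\<close> maximal such that no
  \<open>\<Gamma>' \<rhd> \<Delta>\<close> with \<open>\<Gamma>'\<close> a finite subset of \<open>T\<close> is derivable. By Cut, \<open>T\<close> meets \<open>\<Delta>'\<close> whenever a
  derivable \<open>\<Gamma>' \<rhd> \<Delta>'\<close> has \<open>\<Gamma>' \<subseteq> T\<close>, so \<open>\<phi> \<mapsto> (\<phi> \<in> T, \<not> \<phi> \<in> T)\<close> is a valuation into the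
  four-element bilattice that satisfies \<open>S\<close> and refutes \<open>\<Gamma> \<rhd> \<Delta>\<close>.
\<close>

subsection \<open>Distributive bilattices\<close>

text \<open>Being monotone in both directions and its own inverse, \<open>n\<close> is an order
  isomorphism between the two lattices, so it carries greatest lower bounds to greatest lower
  bounds. Allowing two different lattices covers order-reversing maps: take \<open>m'\<close> to be
  the join.\<close>

lemma involution_preserves_meet:
  assumes m: "lattice_on A m j" and m': "lattice_on A m' j'"
    and n: "\<And>x. x \<in> A \<Longrightarrow> n x \<in> A" "\<And>x. x \<in> A \<Longrightarrow> n (n x) = x"
    and mono: "\<And>x y. x \<in> A \<Longrightarrow> y \<in> A \<Longrightarrow> m x y = x \<Longrightarrow> m' (n x) (n y) = n x"
    and mono': "\<And>x y. x \<in> A \<Longrightarrow> y \<in> A \<Longrightarrow> m' x y = x \<Longrightarrow> m (n x) (n y) = n x"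
    and xy: "x \<in> A" "y \<in> A"
  shows "n (m x y) = m' (n x) (n y)"
proof -
  have closed: "m x y \<in> A" "m' (n x) (n y) \<in> A"
    using m m' n xy unfolding lattice_on_def by auto
  have lower: "p (p a b) a = p a b" "p (p a b) b = p a b"
    if "lattice_on A p q" "a \<in> A" "b \<in> A" for p q a b
    using that unfolding lattice_on_def by metis+
  have greatest: "p c (p a b) = c"
    if "lattice_on A p q" "a \<in> A" "b \<in> A" "c \<in> A" "p c a = c" "p c b = c" for p q a b c
    using that unfolding lattice_on_def by metis
  have 1: "m' (n (m x y)) (m' (n x) (n y)) = n (m x y)"
    by (rule greatest[OF m']) (simp_all add: n xy closed mono lower[OF m])
  \<comment> \<open>For the other inequality, the meet of the images is pulled back along
    \<open>n\<close>: its image lies below \<open>x\<close> and \<open>y\<close>, hence below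
    \<open>m x y\<close>, and \<open>n\<close> is applied again.\<close>
  have "m (n (m' (n x) (n y))) (n (n x)) = n (m' (n x) (n y))"
    "m (n (m' (n x) (n y))) (n (n y)) = n (m' (n x) (n y))"
    by (rule mono'; simp add: n xy closed lower[OF m'])+
  then have "m (n (m' (n x) (n y))) (m x y) = n (m' (n x) (n y))"
    by (intro greatest[OF m]) (simp_all add: n xy closed)
  then have "m' (m' (n x) (n y)) (n (m x y)) = m' (n x) (n y)"
    using mono[of "n (m' (n x) (n y))" "m x y"] by (simp add: n xy closed)
  with 1 m' show ?thesis
    using closed n unfolding lattice_on_def by metis
qed

locale distributive_bilattice =
  fixes B :: "'a alg"
  assumes DBiLat: "B \<in> DBiLat"
begin

abbreviation "A \<equiv> carrier B"
abbreviation "op \<equiv> binop B"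

definition ent (infix "\<sqsubseteq>" 50) where
  "a \<sqsubseteq> b \<longleftrightarrow> op Conj a (op Otimes a b) = a"

lemma lattices:
  "lattice_on A (op Conj) (op Disj)" "lattice_on A (op Disj) (op Conj)"
  "lattice_on A (op Otimes) (op Oplus)" "lattice_on A (op Oplus) (op Otimes)"
  using DBiLat unfolding DBiLat_def bilattice_def lattice_on_def by auto

lemma closed [simp]: "a \<in> A \<Longrightarrow> b \<in> A \<Longrightarrow> op c a b \<in> A" "a \<in> A \<Longrightarrow> neg B a \<in> A"
  using DBiLat unfolding DBiLat_def bilattice_def closed_alg_def by auto

lemma neg_neg [simp]: "a \<in> A \<Longrightarrow> neg B (neg B a) = a"
  using DBiLat unfolding DBiLat_def bilattice_def by auto

lemma comm: "a \<in> A \<Longrightarrow> b \<in> A \<Longrightarrow> op c a b = op c b a"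
  using lattices by (cases c) (auto simp: lattice_on_def)

lemma assoc: "a \<in> A \<Longrightarrow> b \<in> A \<Longrightarrow> d \<in> A \<Longrightarrow> op c (op c a b) d = op c a (op c b d)"
  using lattices by (cases c) (auto simp: lattice_on_def)

lemma absorb [simp]:
  assumes "a \<in> A" "b \<in> A"
  shows "op Conj a (op Disj a b) = a" "op Disj a (op Conj a b) = a"
    "op Otimes a (op Oplus a b) = a" "op Oplus a (op Otimes a b) = a"
  using lattices assms by (auto simp: lattice_on_def)

lemma idem [simp]: "a \<in> A \<Longrightarrow> op c a a = a"
  using absorb closed by (cases c) metis+

lemma left_comm: "a \<in> A \<Longrightarrow> b \<in> A \<Longrightarrow> d \<in> A \<Longrightarrow> op c a (op c b d) = op c b (op c a d)"
  using comm assoc by metis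

lemma left_idem [simp]: "a \<in> A \<Longrightarrow> b \<in> A \<Longrightarrow> op c a (op c a b) = op c a b"
  using assoc idem by metis

lemma distrib:
  "c \<noteq> d \<Longrightarrow> x \<in> A \<Longrightarrow> y \<in> A \<Longrightarrow> z \<in> A \<Longrightarrow>
    op c x (op d y z) = op d (op c x y) (op c x z)"
  using DBiLat unfolding DBiLat_def distributive_def by blast

text \<open>Negation is an involution, antitone for the truth order and monotone for the knowledge
  order. It is therefore an isomorphism from the truth lattice to its dual and from the knowledge
  lattice to itself.\<close>

lemma neg_op:
  assumes "a \<in> A" "b \<in> A"
  shows "neg B (op Conj a b) = op Disj (neg B a) (neg B b)"
    and "neg B (op Disj a b) = op Conj (neg B a) (neg B b)"
    and "neg B (op Otimes a b) = op Otimes (neg B a) (neg B b)"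
    and "neg B (op Oplus a b) = op Oplus (neg B a) (neg B b)"
proof -
  \<comment> \<open>Both orders are also expressed by their joins, since the dual lattices have the
    join as their meet.\<close>
  have t: "op Conj x y = x \<longleftrightarrow> op Disj y x = y" and k: "op Otimes x y = x \<longleftrightarrow> op Oplus y x = y"
    if "x \<in> A" "y \<in> A" for x y
    using absorb comm that by metis+
  have anti: "op Conj (neg B y) (neg B x) = neg B y"
    if "op Conj x y = x" "x \<in> A" "y \<in> A" for x y
    using DBiLat that unfolding DBiLat_def bilattice_def le_t_def by auto
  have mono: "op Otimes (neg B x) (neg B y) = neg B x"
    if "op Otimes x y = x" "x \<in> A" "y \<in> A" for x y
    using DBiLat that unfolding DBiLat_def bilattice_def le_k_def by auto
  show "neg B (op Conj a b) = op Disj (neg B a) (neg B b)"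
    by (rule involution_preserves_meet[OF lattices(1,2)])
      (use assms t anti in \<open>auto simp del: absorb\<close>)
  show "neg B (op Disj a b) = op Conj (neg B a) (neg B b)"
    by (rule involution_preserves_meet[OF lattices(2,1)])
      (use assms t anti in \<open>auto simp del: absorb\<close>)
  show "neg B (op Otimes a b) = op Otimes (neg B a) (neg B b)"
    by (rule involution_preserves_meet[OF lattices(3,3)])
      (use assms mono in \<open>auto simp del: absorb\<close>)
  show "neg B (op Oplus a b) = op Oplus (neg B a) (neg B b)"
    by (rule involution_preserves_meet[OF lattices(4,4)])
      (use assms k mono in \<open>auto simp del: absorb\<close>)
qed

section \<open>The preorder \<sqsubseteq>, its meets and its joins\<close>

lemma ent_iff: "a \<in> A \<Longrightarrow> b \<in> A \<Longrightarrow> a \<sqsubseteq> b \<longleftrightarrow> op Otimes a (op Conj a b) = a"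
  unfolding ent_def by (simp add: distrib[of Conj Otimes])

lemma ent_refl [simp]: "a \<in> A \<Longrightarrow> a \<sqsubseteq> a"
  by (simp add: ent_def)

text \<open>Of the two forms of \<sqsubseteq>, the one whose outer operation is \<open>c\<close> is
  used. The inner operation distributes over \<open>c\<close>, and then \<open>x\<close> lies below
  a \<open>c\<close>-meet in the order of \<open>c\<close> iff it lies below both parts.\<close>

lemma ent_meet:
  assumes "c \<in> {Conj, Otimes}" "x \<in> A" "a \<in> A" "b \<in> A"
  shows "x \<sqsubseteq> op c a b \<longleftrightarrow> x \<sqsubseteq> a \<and> x \<sqsubseteq> b"
proof -
  have split: "op c x (op c a b) = x \<longleftrightarrow> op c x a = x \<and> op c x b = x"
    if "x \<in> A" "a \<in> A" "b \<in> A" for c x a b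
    using that by (metis assoc comm closed(1) left_idem)
  show ?thesis
  proof (cases "c = Conj")
    case True
    then show ?thesis
      using assms split[of x "op Otimes x a" "op Otimes x b" Conj]
      by (simp add: ent_def distrib[of Otimes Conj])
  next
    case False
    then show ?thesis
      using assms split[of x "op Conj x a" "op Conj x b" Otimes]
      by (simp add: ent_iff distrib[of Conj Otimes])
  qed
qed

text \<open>Distributivity puts \<open>a \<otimes> b\<close> below
  \<open>a \<otimes> (b \<otimes> c)\<close> in the truth order, while \<open>a\<close> is below
  \<open>a \<otimes> b\<close>. Hence \<open>a \<sqsubseteq> b \<otimes> c\<close>, and
  \<open>c\<close> is split off by \<open>ent_meet\<close>.\<close>

lemma ent_trans [trans]:
  assumes "a \<sqsubseteq> b" "b \<sqsubseteq> c" "a \<in> A" "b \<in> A" "c \<in> A"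
  shows "a \<sqsubseteq> c"
proof -
  have "op Conj (op Otimes a b) (op Otimes a (op Otimes b c))
      = op Otimes a (op Conj b (op Otimes b c))"
    using assms by (simp add: distrib[of Otimes Conj])
  also have "\<dots> = op Otimes a b"
    using assms by (simp add: ent_def)
  finally have "a \<sqsubseteq> op Otimes b c"
    using assms unfolding ent_def by (metis assoc closed(1))
  then show ?thesis
    using assms by (simp add: ent_meet)
qed

lemma meet_ent:
  assumes "c \<in> {Conj, Otimes}" "a \<in> A" "b \<in> A"
  shows "op c a b \<sqsubseteq> a" "op c a b \<sqsubseteq> b"
  using ent_meet[of c "op c a b" a b] assms by auto

text \<open>Absorption, in the form of \<sqsubseteq> whose inner operation is the meet absorbing
  \<open>c\<close>.\<close>

lemma ent_join:
  assumes "c \<in> {Disj, Oplus}" "a \<in> A" "b \<in> A"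
  shows "a \<sqsubseteq> op c a b" "b \<sqsubseteq> op c a b"
proof -
  have "a \<sqsubseteq> op c a b" if "a \<in> A" "b \<in> A" for a b
  proof (cases "c = Disj")
    case True
    then show ?thesis using that by (simp add: ent_iff)
  next
    case False
    then show ?thesis using that assms(1) by (simp add: ent_def)
  qed
  then show "a \<sqsubseteq> op c a b" "b \<sqsubseteq> op c a b"
    using assms comm by metis+
qed

lemma join_ent:
  assumes "c \<in> {Disj, Oplus}" "x \<in> A" "a \<in> A" "b \<in> A"
  shows "op c a b \<sqsubseteq> x \<longleftrightarrow> a \<sqsubseteq> x \<and> b \<sqsubseteq> x"
proof
  assume "op c a b \<sqsubseteq> x"
  then show "a \<sqsubseteq> x \<and> b \<sqsubseteq> x"
    using ent_join ent_trans assms closed by metis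
next
  assume "a \<sqsubseteq> x \<and> b \<sqsubseteq> x"
  then show "op c a b \<sqsubseteq> x"
  proof (cases "c = Disj")
    case True
    \<comment> \<open>Distributivity turns both sides into joins, so the order is rewritten through
      the join. Then \<open>a\<close> below \<open>a \<otimes> x\<close> and \<open>b\<close> below
      \<open>b \<otimes> x\<close> combine argument by argument.\<close>
    have le: "op Conj u v = u \<longleftrightarrow> op Disj u v = v" if "u \<in> A" "v \<in> A" for u v
      using absorb comm that by metis
    have "op Otimes (op Disj a b) x = op Disj (op Otimes a x) (op Otimes b x)"
      using assms by (simp add: comm[of _ x] distrib[of Otimes Disj])
    moreover have "op Disj (op Disj a b) (op Disj (op Otimes a x) (op Otimes b x))
        = op Disj (op Disj a (op Otimes a x)) (op Disj b (op Otimes b x))"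
      using assms by (simp add: assoc left_comm)
    ultimately show ?thesis
      using \<open>a \<sqsubseteq> x \<and> b \<sqsubseteq> x\<close> assms True by (simp add: ent_def le)
  next
    case False
    have le: "op Otimes u v = u \<longleftrightarrow> op Oplus u v = v" if "u \<in> A" "v \<in> A" for u v
      using absorb comm that by metis
    have "op Conj (op Oplus a b) x = op Oplus (op Conj a x) (op Conj b x)"
      using assms by (simp add: comm[of _ x] distrib[of Conj Oplus])
    moreover have "op Oplus (op Oplus a b) (op Oplus (op Conj a x) (op Conj b x))
        = op Oplus (op Oplus a (op Conj a x)) (op Oplus b (op Conj b x))"
      using assms by (simp add: assoc left_comm)
    ultimately show ?thesis
      using \<open>a \<sqsubseteq> x \<and> b \<sqsubseteq> x\<close> assms False by (simp add: ent_iff le)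
  qed
qed

section \<open>Algebraic forms of Cut and of the two-premise rules\<close>

lemma conj_ent_left: "a \<sqsubseteq> x \<Longrightarrow> a \<in> A \<Longrightarrow> b \<in> A \<Longrightarrow> x \<in> A \<Longrightarrow> op Conj a b \<sqsubseteq> x"
  by (rule ent_trans[of _ a]) (simp_all add: meet_ent)

lemma ent_disj_left: "x \<sqsubseteq> a \<Longrightarrow> a \<in> A \<Longrightarrow> b \<in> A \<Longrightarrow> x \<in> A \<Longrightarrow> x \<sqsubseteq> op Disj a b"
  by (rule ent_trans[of _ a]) (simp_all add: ent_join)

text \<open>Distributing \<and> over \<or> in \<open>x \<and> (y \<or> p)\<close> leaves a join of
  \<open>x \<and> y\<close> and \<open>x \<and> p\<close>, both of which entail
  \<open>y\<close>.\<close>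

lemma ent_cut:
  assumes "x \<sqsubseteq> op Disj y p" "op Conj x p \<sqsubseteq> y" "x \<in> A" "y \<in> A" "p \<in> A"
  shows "x \<sqsubseteq> y"
proof -
  have "x \<sqsubseteq> op Conj x (op Disj y p)"
    using assms by (simp add: ent_meet)
  also have "op Conj x (op Disj y p) \<sqsubseteq> y"
    using assms by (simp add: distrib[of Conj Disj] join_ent meet_ent)
  finally show ?thesis using assms by simp
qed

text \<open>Two cuts, on \<open>p\<close> and then on \<open>q\<close>:
  \<open>x \<and> p \<and> q\<close> entails \<open>p\<close> and \<open>q\<close>, hence their
  \<open>c\<close>-meet, whichever of the two meets \<open>c\<close> is.\<close>

lemma ent_meet_cut:
  assumes c: "c \<in> {Conj, Otimes}" and "x \<sqsubseteq> op Disj y p" "x \<sqsubseteq> op Disj y q" "op c p q \<sqsubseteq> y"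
    and A: "x \<in> A" "y \<in> A" "p \<in> A" "q \<in> A"
  shows "x \<sqsubseteq> y"
proof (rule ent_cut[OF assms(2)])
  show "op Conj x p \<sqsubseteq> y"
  proof (rule ent_cut[of _ _ q])
    show "op Conj x p \<sqsubseteq> op Disj y q"
      using assms(3) A by (simp add: conj_ent_left)
    have "op Conj (op Conj x p) q \<sqsubseteq> p"
      using A by (simp add: conj_ent_left meet_ent)
    then have "op Conj (op Conj x p) q \<sqsubseteq> op c p q"
      using A ent_meet[OF c, of "op Conj (op Conj x p) q" p q]
        meet_ent(2)[of Conj "op Conj x p" q] by simp
    then show "op Conj (op Conj x p) q \<sqsubseteq> y"
      by (rule ent_trans[OF _ assms(4)]) (use A in auto)
  qed (use A in auto)
qed (use A in auto)

text \<open>Dual to \<open>ent_meet_cut\<close>: either \<open>c\<close>-join of \<open>p\<close>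
  and \<open>q\<close> entails \<open>y \<or> p \<or> q\<close>, and \<open>q\<close> and
  \<open>p\<close> are cut away.\<close>

lemma ent_join_cut:
  assumes c: "c \<in> {Disj, Oplus}" and "op Conj x p \<sqsubseteq> y" "op Conj x q \<sqsubseteq> y" "x \<sqsubseteq> op c p q"
    and A: "x \<in> A" "y \<in> A" "p \<in> A" "q \<in> A"
  shows "x \<sqsubseteq> y"
proof (rule ent_cut[OF _ assms(2)])
  show "x \<sqsubseteq> op Disj y p"
  proof (rule ent_cut[of _ _ q])
    show "op Conj x q \<sqsubseteq> op Disj y p"
      using assms(3) A by (simp add: ent_disj_left)
    have "p \<sqsubseteq> op Disj (op Disj y p) q"
      using A by (simp add: ent_disj_left ent_join)
    then have "op c p q \<sqsubseteq> op Disj (op Disj y p) q"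
      using A join_ent[OF c, of "op Disj (op Disj y p) q" p q]
        ent_join(2)[of Disj "op Disj y p" q] by simp
    with assms(4) show "x \<sqsubseteq> op Disj (op Disj y p) q"
      by (rule ent_trans) (use A in auto)
  qed (use A in auto)
qed (use A in auto)

text \<open>From \<open>a \<sqsubseteq> b\<close>, \<open>a\<close> is below
  \<open>a \<otimes> b\<close> in the truth order. The same for the negations, negated once more,
  gives the reverse inequality, so \<open>a = a \<otimes> b\<close>; by symmetry
  \<open>b = b \<otimes> a\<close>.\<close>

lemma ent_neg_antisym:
  assumes "a \<sqsubseteq> b" "neg B a \<sqsubseteq> neg B b" "b \<sqsubseteq> a" "neg B b \<sqsubseteq> neg B a" and A: "a \<in> A" "b \<in> A"
  shows "a = b"
proof -
  have "a = op Otimes a b"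
    if "a \<sqsubseteq> b" "neg B a \<sqsubseteq> neg B b" "a \<in> A" "b \<in> A" for a b
  proof -
    have "neg B (op Conj (neg B a) (neg B (op Otimes a b))) = neg B (neg B a)"
      using that by (simp add: ent_def neg_op)
    then have "op Disj a (op Otimes a b) = a"
      using that by (simp add: neg_op)
    then have "op Conj a (op Otimes a b) = op Otimes a b"
      using that absorb comm closed(1) by metis
    with that show ?thesis by (simp add: ent_def)
  qed
  from this[of a b] this[of b a] show ?thesis
    using assms comm by metis
qed

end


subsection \<open>Soundness\<close>

context distributive_bilattice
begin

lemma eval_closed [simp]: "range h \<subseteq> A \<Longrightarrow> eval B h \<phi> \<in> A"
  by (induction \<phi>) auto

text \<open>
  This phrasing of \<open>\<And>\<Gamma> \<sqsubseteq> \<Or>\<Delta>\<close> is independent of the order and bracketing of the members, and it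
  still makes sense when \<open>\<Gamma>\<close> or \<open>\<Delta>\<close> is empty.
\<close>

definition seq_holds :: "('v \<Rightarrow> 'a) \<Rightarrow> 'v seq \<Rightarrow> bool" where
  "seq_holds h s \<longleftrightarrow> (\<forall>x\<in>A. \<forall>y\<in>A.
     (\<forall>\<gamma>\<in>fst s. x \<sqsubseteq> eval B h \<gamma>) \<longrightarrow> (\<forall>\<delta>\<in>snd s. eval B h \<delta> \<sqsubseteq> y) \<longrightarrow> x \<sqsubseteq> y)"

lemma seq_holdsI:
  assumes "\<And>x y. x \<in> A \<Longrightarrow> y \<in> A \<Longrightarrow> \<forall>\<gamma>\<in>\<Gamma>. x \<sqsubseteq> eval B h \<gamma> \<Longrightarrow> \<forall>\<delta>\<in>\<Delta>. eval B h \<delta> \<sqsubseteq> y \<Longrightarrow> x \<sqsubseteq> y"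
  shows "seq_holds h (\<Gamma> \<rhd> \<Delta>)"
  using assms by (simp add: seq_holds_def)

lemma seq_holdsD:
  assumes "seq_holds h (\<Gamma> \<rhd> \<Delta>)" "x \<in> A" "y \<in> A"
    and "\<And>\<gamma>. \<gamma> \<in> \<Gamma> \<Longrightarrow> x \<sqsubseteq> eval B h \<gamma>" "\<And>\<delta>. \<delta> \<in> \<Delta> \<Longrightarrow> eval B h \<delta> \<sqsubseteq> y"
  shows "x \<sqsubseteq> y"
  using assms unfolding seq_holds_def fst_conv snd_conv by blast

text \<open>Serves the one-premise rules: it suffices that bounds for the conclusion are bounds for
  the premise.\<close>

lemma seq_holds_mono:
  assumes "seq_holds h (\<Gamma> \<rhd> \<Delta>)"
    and "\<And>x \<gamma>. x \<in> A \<Longrightarrow> \<forall>\<gamma>\<in>\<Gamma>'. x \<sqsubseteq> eval B h \<gamma> \<Longrightarrow> \<gamma> \<in> \<Gamma> \<Longrightarrow> x \<sqsubseteq> eval B h \<gamma>"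
    and "\<And>y \<delta>. y \<in> A \<Longrightarrow> \<forall>\<delta>\<in>\<Delta>'. eval B h \<delta> \<sqsubseteq> y \<Longrightarrow> \<delta> \<in> \<Delta> \<Longrightarrow> eval B h \<delta> \<sqsubseteq> y"
  shows "seq_holds h (\<Gamma>' \<rhd> \<Delta>')"
  using assms unfolding seq_holds_def fst_conv snd_conv by blast

lemma ent_combination:
  assumes "combination Conj X \<phi>" "range h \<subseteq> A" "x \<in> A"
  shows "x \<sqsubseteq> eval B h \<phi> \<longleftrightarrow> (\<forall>\<gamma>\<in>X. x \<sqsubseteq> eval B h \<gamma>)"
  using assms(1) by induction (use assms(2,3) in \<open>auto simp: ent_meet\<close>)

lemma combination_ent:
  assumes "combination Disj X \<phi>" "range h \<subseteq> A" "y \<in> A"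
  shows "eval B h \<phi> \<sqsubseteq> y \<longleftrightarrow> (\<forall>\<delta>\<in>X. eval B h \<delta> \<sqsubseteq> y)"
  using assms(1) by induction (use assms(2,3) in \<open>auto simp: join_ent\<close>)

lemma seq_holds_combination:
  assumes "combination Conj \<Gamma> \<phi>" "combination Disj \<Delta> \<psi>" and h: "range h \<subseteq> A"
  shows "seq_holds h (\<Gamma> \<rhd> \<Delta>) \<longleftrightarrow> eval B h \<phi> \<sqsubseteq> eval B h \<psi>"
proof -
  have "seq_holds h (\<Gamma> \<rhd> \<Delta>) \<longleftrightarrow>
      (\<forall>x\<in>A. \<forall>y\<in>A. x \<sqsubseteq> eval B h \<phi> \<longrightarrow> eval B h \<psi> \<sqsubseteq> y \<longrightarrow> x \<sqsubseteq> y)"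
    using assms by (simp add: seq_holds_def ent_combination combination_ent)
  \<comment> \<open>From left to right, \<open>x\<close> and \<open>y\<close> are taken to be the
    values of \<open>\<phi>\<close> and \<open>\<psi>\<close> themselves.\<close>
  also have "\<dots> \<longleftrightarrow> eval B h \<phi> \<sqsubseteq> eval B h \<psi>"
    using h by (meson ent_refl ent_trans eval_closed)
  finally show ?thesis .
qed

text \<open>The premise is used at the lower bound \<open>x \<and> \<phi>\<close>. This and the dual
  lemma after it bring premises into the shape of the cut laws.\<close>

lemma seq_holds_left:
  assumes "seq_holds h (insert \<phi> \<Gamma> \<rhd> \<Delta>)" "range h \<subseteq> A" "x \<in> A" "y \<in> A"
    and "\<forall>\<gamma>\<in>\<Gamma>. x \<sqsubseteq> eval B h \<gamma>" "\<forall>\<delta>\<in>\<Delta>. eval B h \<delta> \<sqsubseteq> y"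
  shows "op Conj x (eval B h \<phi>) \<sqsubseteq> y"
  by (rule seq_holdsD[OF assms(1)]) (use assms(2-) in \<open>auto simp: meet_ent conj_ent_left\<close>)

lemma seq_holds_right:
  assumes "seq_holds h (\<Gamma> \<rhd> insert \<phi> \<Delta>)" "range h \<subseteq> A" "x \<in> A" "y \<in> A"
    and "\<forall>\<gamma>\<in>\<Gamma>. x \<sqsubseteq> eval B h \<gamma>" "\<forall>\<delta>\<in>\<Delta>. eval B h \<delta> \<sqsubseteq> y"
  shows "x \<sqsubseteq> op Disj y (eval B h \<phi>)"
  by (rule seq_holdsD[OF assms(1)]) (use assms(2-) in \<open>auto simp: ent_join ent_disj_left\<close>)

text \<open>Only the value of \<open>\<chi>\<close> is constrained, so this covers the right rules
  for \<and>, \<otimes>, negated \<or> and negated \<otimes> alike;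
  \<open>seq_holds_join_left\<close> does the same for the left rules of the joins.\<close>

lemma seq_holds_meet_right:
  assumes "seq_holds h (\<Gamma> \<rhd> insert \<phi> \<Delta>)" "seq_holds h (\<Gamma> \<rhd> insert \<psi> \<Delta>)" "range h \<subseteq> A"
    and "c \<in> {Conj, Otimes}" "eval B h \<chi> = op c (eval B h \<phi>) (eval B h \<psi>)"
  shows "seq_holds h (\<Gamma> \<rhd> insert \<chi> \<Delta>)"
proof (rule seq_holdsI)
  fix x y
  assume "x \<in> A" "y \<in> A" "\<forall>\<gamma>\<in>\<Gamma>. x \<sqsubseteq> eval B h \<gamma>"
    and "\<forall>\<delta>\<in>insert \<chi> \<Delta>. eval B h \<delta> \<sqsubseteq> y"
  then show "x \<sqsubseteq> y"
    by - (rule ent_meet_cut[OF assms(4) seq_holds_right[OF assms(1,3)] seq_holds_right[OF assms(2,3)]],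
        use assms(3,5) in auto)
qed

lemma seq_holds_join_left:
  assumes "seq_holds h (insert \<phi> \<Gamma> \<rhd> \<Delta>)" "seq_holds h (insert \<psi> \<Gamma> \<rhd> \<Delta>)" "range h \<subseteq> A"
    and "c \<in> {Disj, Oplus}" "eval B h \<chi> = op c (eval B h \<phi>) (eval B h \<psi>)"
  shows "seq_holds h (insert \<chi> \<Gamma> \<rhd> \<Delta>)"
proof (rule seq_holdsI)
  fix x y
  assume "x \<in> A" "y \<in> A" "\<forall>\<gamma>\<in>insert \<chi> \<Gamma>. x \<sqsubseteq> eval B h \<gamma>"
    and "\<forall>\<delta>\<in>\<Delta>. eval B h \<delta> \<sqsubseteq> y"
  then show "x \<sqsubseteq> y"
    by - (rule ent_join_cut[OF assms(4) seq_holds_left[OF assms(1,3)] seq_holds_left[OF assms(2,3)]],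
        use assms(3,5) in auto)
qed

lemma seq_holds_cut:
  assumes "seq_holds h (\<Gamma> \<rhd> insert \<phi> \<Delta>)" "seq_holds h (insert \<phi> \<Gamma>' \<rhd> \<Delta>')" "range h \<subseteq> A"
  shows "seq_holds h (\<Gamma> \<union> \<Gamma>' \<rhd> \<Delta> \<union> \<Delta>')"
proof (rule seq_holdsI)
  fix x y
  assume "x \<in> A" "y \<in> A" "\<forall>\<gamma>\<in>\<Gamma> \<union> \<Gamma>'. x \<sqsubseteq> eval B h \<gamma>" "\<forall>\<delta>\<in>\<Delta> \<union> \<Delta>'. eval B h \<delta> \<sqsubseteq> y"
  then show "x \<sqsubseteq> y"
    by - (rule ent_cut[OF seq_holds_right[OF assms(1,3)] seq_holds_left[OF assms(2,3)]],
        use assms(3) in auto)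
qed

theorem derivable_sound:
  assumes "derivable S s" "range h \<subseteq> A" "\<forall>s'\<in>S. seq_holds h s'"
  shows "seq_holds h s"
proof -
  have closed_eval: "eval B h \<phi> \<in> A" for \<phi>
    using assms(2) by simp
  show ?thesis
    using assms(1)
  proof induction
    case (Hyp s)
    then show ?case using assms(3) by blast
  next
    case (Ax \<Gamma> \<Delta> \<phi>)
    show ?case
      unfolding seq_holds_def by (auto intro: ent_trans[of _ "eval B h \<phi>"] closed_eval)
  next
    case (Cut \<Gamma> \<phi> \<Delta> \<Gamma>' \<Delta>')
    then show ?case using assms(2) by (blast intro: seq_holds_cut)
  next
    case ConjR
    show ?case
      by (rule seq_holds_meet_right[OF ConjR.IH assms(2), of Conj]) simp_all
  next
    case NegDisjR
    show ?case
      by (rule seq_holds_meet_right[OF NegDisjR.IH assms(2), of Conj]) (simp_all add: closed_eval neg_op)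
  next
    case OtimesR
    show ?case
      by (rule seq_holds_meet_right[OF OtimesR.IH assms(2), of Otimes]) simp_all
  next
    case NegOtimesR
    show ?case
      by (rule seq_holds_meet_right[OF NegOtimesR.IH assms(2), of Otimes]) (simp_all add: closed_eval neg_op)
  next
    case DisjL
    show ?case
      by (rule seq_holds_join_left[OF DisjL.IH assms(2), of Disj]) simp_all
  next
    case NegConjL
    show ?case
      by (rule seq_holds_join_left[OF NegConjL.IH assms(2), of Disj]) (simp_all add: closed_eval neg_op)
  next
    case OplusL
    show ?case
      by (rule seq_holds_join_left[OF OplusL.IH assms(2), of Oplus]) simp_all
  next
    case NegOplusL
    show ?case
      by (rule seq_holds_join_left[OF NegOplusL.IH assms(2), of Oplus]) (simp_all add: closed_eval neg_op)
  \<comment> \<open>The remaining rules have one premise; their principal formula has the same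
    bounds as its parts, by \<open>ent_meet\<close>, \<open>join_ent\<close> and the De Morgan
    laws.\<close>
  qed (erule seq_holds_mono; auto simp: closed_eval neg_op ent_meet join_ent)+
qed

end


subsection \<open>Prime theories\<close>

text \<open>Weakening is a Cut against an axiom that carries the new formulas; the cut formula is
  some member of \<open>\<Delta>\<close>, which exists because right sides are non-empty.\<close>

lemma derivable_weaken:
  assumes "derivable S (\<Gamma> \<rhd> \<Delta>)" "S \<subseteq> sequents" "finite \<Gamma>'" "finite \<Delta>'"
  shows "derivable S (\<Gamma> \<union> \<Gamma>' \<rhd> \<Delta> \<union> \<Delta>')"
proof -
  obtain \<delta> where "\<delta> \<in> \<Delta>"
    using derivable_sequents[OF assms(1,2)] by (auto simp: sequents_def)
  then have "derivable S (\<Gamma> \<rhd> insert \<delta> \<Delta>)"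
    using assms(1) by (simp add: insert_absorb)
  from Cut[OF this Ax[OF assms(3,4)]] show ?thesis
    using \<open>\<delta> \<in> \<Delta>\<close> by (simp add: insert_absorb)
qed

definition prime_theory :: "'v seq set \<Rightarrow> 'v fm set \<Rightarrow> bool" where
  "prime_theory S T \<longleftrightarrow> (\<forall>\<Gamma> \<Delta>. derivable S (\<Gamma> \<rhd> \<Delta>) \<longrightarrow> \<Gamma> \<subseteq> T \<longrightarrow> \<Delta> \<inter> T \<noteq> {})"

lemma prime_theory_exists:
  assumes S: "S \<subseteq> sequents" and s: "(\<Gamma> \<rhd> \<Delta>) \<in> sequents" and nd: "\<not> derivable S (\<Gamma> \<rhd> \<Delta>)"
  obtains T where "prime_theory S T" "\<Gamma> \<subseteq> T" "\<Delta> \<inter> T = {}"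
proof -
  define C where "C = {T. \<Gamma> \<subseteq> T \<and> (\<forall>F. finite F \<longrightarrow> F \<subseteq> T \<longrightarrow> \<not> derivable S (F \<rhd> \<Delta>))}"
  have fin: "finite \<Gamma>" "finite \<Delta>"
    using s by (auto simp: sequents_def)
  have "\<exists>T\<in>C. \<forall>X\<in>C. T \<subseteq> X \<longrightarrow> X = T"
  proof (rule subset_Zorn_nonempty)
    have "\<not> derivable S (F \<rhd> \<Delta>)" if "F \<subseteq> \<Gamma>" for F
      using derivable_weaken[OF _ S fin(1), of F \<Delta> "{}"] nd that by (auto simp: sup.absorb2)
    then show "C \<noteq> {}" by (auto simp: C_def)
  next
    fix \<C> assume \<C>: "\<C> \<noteq> {}" "subset.chain C \<C>"
    then have sub: "\<C> \<subseteq> C" by (simp add: subset.chain_def)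
    have "\<not> derivable S (F \<rhd> \<Delta>)" if F: "finite F" "F \<subseteq> \<Union>\<C>" for F
    proof -
      \<comment> \<open>Finiteness of \<open>F\<close> matters here: a finite subset of the union of
        a chain lies in a single member.\<close>
      obtain X where "X \<in> \<C>" "F \<subseteq> X"
        using finite_subset_Union_chain[OF F \<C>] by blast
      then show ?thesis using sub F(1) by (auto simp: C_def)
    qed
    moreover have "\<Gamma> \<subseteq> \<Union>\<C>"
      using \<C>(1) sub by (auto simp: C_def)
    ultimately show "\<Union>\<C> \<in> C" by (simp add: C_def)
  qed
  then obtain T where T: "T \<in> C" and max: "\<And>X. X \<in> C \<Longrightarrow> T \<subseteq> X \<Longrightarrow> X = T"
    by blast
  have outside: "\<exists>F. finite F \<and> F \<subseteq> T \<and> derivable S (insert \<phi> F \<rhd> \<Delta>)" if \<phi>: "\<phi> \<notin> T" for \<phi>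
  proof -
    have "insert \<phi> T \<notin> C" using max[of "insert \<phi> T"] \<phi> by blast
    then obtain F where F: "finite F" "F \<subseteq> insert \<phi> T" "derivable S (F \<rhd> \<Delta>)"
      using T by (auto simp: C_def)
    \<comment> \<open>Weakening ensures that \<open>\<phi>\<close> occurs on the left, and removing
      it from \<open>F\<close> leaves a subset of \<open>T\<close>; this is the shape that Cut
      expects.\<close>
    from derivable_weaken[OF F(3) S, of "{\<phi>}" "{}"]
    have "derivable S (insert \<phi> (F - {\<phi>}) \<rhd> \<Delta>)" by simp
    then show ?thesis using F by blast
  qed
  \<comment> \<open>Members of \<open>\<Delta>'\<close> outside \<open>T\<close> are cut away one by
    one against the sequents from \<open>outside\<close>. If all were outside, a derivable
    \<open>F \<rhd> \<Delta>\<close> would remain, contradicting \<open>T \<in> C\<close>.\<close>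
  have cut: "\<Delta>' \<inter> T \<noteq> {}"
    if "finite \<Delta>'" "finite F" "F \<subseteq> T" "derivable S (F \<rhd> \<Delta>' \<union> \<Delta>)" for F \<Delta>'
    using that
  proof (induction \<Delta>' arbitrary: F rule: finite_induct)
    case empty
    then show ?case using T by (auto simp: C_def)
  next
    case (insert \<phi> \<Delta>')
    show ?case
    proof (cases "\<phi> \<in> T")
      case False
      then obtain G where G: "finite G" "G \<subseteq> T" "derivable S (insert \<phi> G \<rhd> \<Delta>)"
        using outside by blast
      have "derivable S (F \<union> G \<rhd> (\<Delta>' \<union> \<Delta>) \<union> \<Delta>)"
        using Cut[of S F \<phi> "\<Delta>' \<union> \<Delta>" G \<Delta>] insert.prems G by simp
      then show ?thesis
        using insert.IH[of "F \<union> G"] insert.prems G by (simp add: Un_assoc)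
    qed auto
  qed
  have "prime_theory S T"
    unfolding prime_theory_def
  proof (intro allI impI)
    fix \<Gamma>' \<Delta>' assume d: "derivable S (\<Gamma>' \<rhd> \<Delta>')" and sub: "\<Gamma>' \<subseteq> T"
    then have "finite \<Gamma>'" "finite \<Delta>'"
      using derivable_sequents[OF d S] by (auto simp: sequents_def)
    then show "\<Delta>' \<inter> T \<noteq> {}"
      using cut[of \<Delta>' \<Gamma>'] sub derivable_weaken[OF d S, of "{}" \<Delta>] fin by simp
  qed
  moreover have "\<delta> \<notin> T" if "\<delta> \<in> \<Delta>" for \<delta>
  proof
    assume "\<delta> \<in> T"
    moreover have "derivable S ({\<delta>} \<rhd> \<Delta>)"
      using Ax[of "{}" \<Delta> S \<delta>] that fin by (simp add: insert_absorb)
    ultimately show False using T by (auto simp: C_def)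
  qed
  ultimately show ?thesis
    using that[of T] T by (auto simp: C_def)
qed

text \<open>These sequents encode the truth conditions of all connectives and of their negations; a
  prime theory respects each of them.\<close>

lemma derivable_connectives:
  "derivable S ({\<phi> \<^bold>\<and> \<psi>} \<rhd> {\<phi>})" "derivable S ({\<phi> \<^bold>\<and> \<psi>} \<rhd> {\<psi>})"
  "derivable S ({\<phi>, \<psi>} \<rhd> {\<phi> \<^bold>\<and> \<psi>})"
  "derivable S ({\<phi> \<^bold>\<otimes> \<psi>} \<rhd> {\<phi>})" "derivable S ({\<phi> \<^bold>\<otimes> \<psi>} \<rhd> {\<psi>})"
  "derivable S ({\<phi>, \<psi>} \<rhd> {\<phi> \<^bold>\<otimes> \<psi>})"
  "derivable S ({\<phi>} \<rhd> {\<phi> \<^bold>\<or> \<psi>})" "derivable S ({\<psi>} \<rhd> {\<phi> \<^bold>\<or> \<psi>})"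
  "derivable S ({\<phi> \<^bold>\<or> \<psi>} \<rhd> {\<phi>, \<psi>})"
  "derivable S ({\<phi>} \<rhd> {\<phi> \<^bold>\<oplus> \<psi>})" "derivable S ({\<psi>} \<rhd> {\<phi> \<^bold>\<oplus> \<psi>})"
  "derivable S ({\<phi> \<^bold>\<oplus> \<psi>} \<rhd> {\<phi>, \<psi>})"
  "derivable S ({\<^bold>\<not> (\<phi> \<^bold>\<or> \<psi>)} \<rhd> {\<^bold>\<not> \<phi>})" "derivable S ({\<^bold>\<not> (\<phi> \<^bold>\<or> \<psi>)} \<rhd> {\<^bold>\<not> \<psi>})"
  "derivable S ({\<^bold>\<not> \<phi>, \<^bold>\<not> \<psi>} \<rhd> {\<^bold>\<not> (\<phi> \<^bold>\<or> \<psi>)})"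
  "derivable S ({\<^bold>\<not> (\<phi> \<^bold>\<otimes> \<psi>)} \<rhd> {\<^bold>\<not> \<phi>})" "derivable S ({\<^bold>\<not> (\<phi> \<^bold>\<otimes> \<psi>)} \<rhd> {\<^bold>\<not> \<psi>})"
  "derivable S ({\<^bold>\<not> \<phi>, \<^bold>\<not> \<psi>} \<rhd> {\<^bold>\<not> (\<phi> \<^bold>\<otimes> \<psi>)})"
  "derivable S ({\<^bold>\<not> \<phi>} \<rhd> {\<^bold>\<not> (\<phi> \<^bold>\<and> \<psi>)})" "derivable S ({\<^bold>\<not> \<psi>} \<rhd> {\<^bold>\<not> (\<phi> \<^bold>\<and> \<psi>)})"
  "derivable S ({\<^bold>\<not> (\<phi> \<^bold>\<and> \<psi>)} \<rhd> {\<^bold>\<not> \<phi>, \<^bold>\<not> \<psi>})"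
  "derivable S ({\<^bold>\<not> \<phi>} \<rhd> {\<^bold>\<not> (\<phi> \<^bold>\<oplus> \<psi>)})" "derivable S ({\<^bold>\<not> \<psi>} \<rhd> {\<^bold>\<not> (\<phi> \<^bold>\<oplus> \<psi>)})"
  "derivable S ({\<^bold>\<not> (\<phi> \<^bold>\<oplus> \<psi>)} \<rhd> {\<^bold>\<not> \<phi>, \<^bold>\<not> \<psi>})"
  "derivable S ({\<^bold>\<not> (\<^bold>\<not> \<phi>)} \<rhd> {\<phi>})" "derivable S ({\<phi>} \<rhd> {\<^bold>\<not> (\<^bold>\<not> \<phi>)})"
proof -
  have ax: "derivable S (\<Gamma> \<rhd> \<Delta>)" if "finite \<Gamma>" "finite \<Delta>" "\<chi> \<in> \<Gamma>" "\<chi> \<in> \<Delta>" for \<Gamma> \<Delta> and \<chi> :: "'a fm"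
    using Ax[of \<Gamma> \<Delta> S \<chi>] that by (simp add: insert_absorb)
  show "derivable S ({\<phi> \<^bold>\<and> \<psi>} \<rhd> {\<phi>})" "derivable S ({\<phi> \<^bold>\<and> \<psi>} \<rhd> {\<psi>})"
    by (rule ConjL, rule ax, auto)+
  show "derivable S ({\<phi> \<^bold>\<otimes> \<psi>} \<rhd> {\<phi>})" "derivable S ({\<phi> \<^bold>\<otimes> \<psi>} \<rhd> {\<psi>})"
    by (rule OtimesL, rule ax, auto)+
  show "derivable S ({\<^bold>\<not> (\<phi> \<^bold>\<or> \<psi>)} \<rhd> {\<^bold>\<not> \<phi>})" "derivable S ({\<^bold>\<not> (\<phi> \<^bold>\<or> \<psi>)} \<rhd> {\<^bold>\<not> \<psi>})"
    by (rule NegDisjL, rule ax, auto)+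
  show "derivable S ({\<^bold>\<not> (\<phi> \<^bold>\<otimes> \<psi>)} \<rhd> {\<^bold>\<not> \<phi>})" "derivable S ({\<^bold>\<not> (\<phi> \<^bold>\<otimes> \<psi>)} \<rhd> {\<^bold>\<not> \<psi>})"
    by (rule NegOtimesL, rule ax, auto)+
  show "derivable S ({\<phi>, \<psi>} \<rhd> {\<phi> \<^bold>\<and> \<psi>})"
    by (rule ConjR; rule ax) auto
  show "derivable S ({\<phi>, \<psi>} \<rhd> {\<phi> \<^bold>\<otimes> \<psi>})"
    by (rule OtimesR; rule ax) auto
  show "derivable S ({\<^bold>\<not> \<phi>, \<^bold>\<not> \<psi>} \<rhd> {\<^bold>\<not> (\<phi> \<^bold>\<or> \<psi>)})"
    by (rule NegDisjR; rule ax) auto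
  show "derivable S ({\<^bold>\<not> \<phi>, \<^bold>\<not> \<psi>} \<rhd> {\<^bold>\<not> (\<phi> \<^bold>\<otimes> \<psi>)})"
    by (rule NegOtimesR; rule ax) auto
  show "derivable S ({\<phi>} \<rhd> {\<phi> \<^bold>\<or> \<psi>})" "derivable S ({\<psi>} \<rhd> {\<phi> \<^bold>\<or> \<psi>})"
    by (rule DisjR, rule ax, auto)+
  show "derivable S ({\<phi>} \<rhd> {\<phi> \<^bold>\<oplus> \<psi>})" "derivable S ({\<psi>} \<rhd> {\<phi> \<^bold>\<oplus> \<psi>})"
    by (rule OplusR, rule ax, auto)+
  show "derivable S ({\<^bold>\<not> \<phi>} \<rhd> {\<^bold>\<not> (\<phi> \<^bold>\<and> \<psi>)})" "derivable S ({\<^bold>\<not> \<psi>} \<rhd> {\<^bold>\<not> (\<phi> \<^bold>\<and> \<psi>)})"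
    by (rule NegConjR, rule ax, auto)+
  show "derivable S ({\<^bold>\<not> \<phi>} \<rhd> {\<^bold>\<not> (\<phi> \<^bold>\<oplus> \<psi>)})" "derivable S ({\<^bold>\<not> \<psi>} \<rhd> {\<^bold>\<not> (\<phi> \<^bold>\<oplus> \<psi>)})"
    by (rule NegOplusR, rule ax, auto)+
  show "derivable S ({\<phi> \<^bold>\<or> \<psi>} \<rhd> {\<phi>, \<psi>})"
    by (rule DisjL; rule ax) auto
  show "derivable S ({\<phi> \<^bold>\<oplus> \<psi>} \<rhd> {\<phi>, \<psi>})"
    by (rule OplusL; rule ax) auto
  show "derivable S ({\<^bold>\<not> (\<phi> \<^bold>\<and> \<psi>)} \<rhd> {\<^bold>\<not> \<phi>, \<^bold>\<not> \<psi>})"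
    by (rule NegConjL; rule ax) auto
  show "derivable S ({\<^bold>\<not> (\<phi> \<^bold>\<oplus> \<psi>)} \<rhd> {\<^bold>\<not> \<phi>, \<^bold>\<not> \<psi>})"
    by (rule NegOplusL; rule ax) auto
  show "derivable S ({\<^bold>\<not> (\<^bold>\<not> \<phi>)} \<rhd> {\<phi>})"
    by (rule NegNegL; rule ax) auto
  show "derivable S ({\<phi>} \<rhd> {\<^bold>\<not> (\<^bold>\<not> \<phi>)})"
    by (rule NegNegR; rule ax) auto
qed

lemma prime_theory_iffs:
  assumes "prime_theory S T"
  shows "\<phi> \<^bold>\<and> \<psi> \<in> T \<longleftrightarrow> \<phi> \<in> T \<and> \<psi> \<in> T"
    and "\<phi> \<^bold>\<otimes> \<psi> \<in> T \<longleftrightarrow> \<phi> \<in> T \<and> \<psi> \<in> T"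
    and "\<phi> \<^bold>\<or> \<psi> \<in> T \<longleftrightarrow> \<phi> \<in> T \<or> \<psi> \<in> T"
    and "\<phi> \<^bold>\<oplus> \<psi> \<in> T \<longleftrightarrow> \<phi> \<in> T \<or> \<psi> \<in> T"
    and "\<^bold>\<not> (\<phi> \<^bold>\<and> \<psi>) \<in> T \<longleftrightarrow> \<^bold>\<not> \<phi> \<in> T \<or> \<^bold>\<not> \<psi> \<in> T"
    and "\<^bold>\<not> (\<phi> \<^bold>\<otimes> \<psi>) \<in> T \<longleftrightarrow> \<^bold>\<not> \<phi> \<in> T \<and> \<^bold>\<not> \<psi> \<in> T"
    and "\<^bold>\<not> (\<phi> \<^bold>\<or> \<psi>) \<in> T \<longleftrightarrow> \<^bold>\<not> \<phi> \<in> T \<and> \<^bold>\<not> \<psi> \<in> T"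
    and "\<^bold>\<not> (\<phi> \<^bold>\<oplus> \<psi>) \<in> T \<longleftrightarrow> \<^bold>\<not> \<phi> \<in> T \<or> \<^bold>\<not> \<psi> \<in> T"
    and "\<^bold>\<not> (\<^bold>\<not> \<phi>) \<in> T \<longleftrightarrow> \<phi> \<in> T"
proof -
  have closed: "\<Delta> \<inter> T \<noteq> {}" if "derivable S (\<Gamma> \<rhd> \<Delta>)" "\<Gamma> \<subseteq> T" for \<Gamma> \<Delta>
    using assms that by (auto simp: prime_theory_def)
  note * = derivable_connectives(1-24)[where S = S and \<phi> = \<phi> and \<psi> = \<psi>, THEN closed]
    and nn = derivable_connectives(25,26)[where S = S and \<phi> = \<phi>, THEN closed]
  show "\<phi> \<^bold>\<and> \<psi> \<in> T \<longleftrightarrow> \<phi> \<in> T \<and> \<psi> \<in> T" using *(1-3) by blast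
  show "\<phi> \<^bold>\<otimes> \<psi> \<in> T \<longleftrightarrow> \<phi> \<in> T \<and> \<psi> \<in> T" using *(4-6) by blast
  show "\<phi> \<^bold>\<or> \<psi> \<in> T \<longleftrightarrow> \<phi> \<in> T \<or> \<psi> \<in> T" using *(7-9) by blast
  show "\<phi> \<^bold>\<oplus> \<psi> \<in> T \<longleftrightarrow> \<phi> \<in> T \<or> \<psi> \<in> T" using *(10-12) by blast
  show "\<^bold>\<not> (\<phi> \<^bold>\<or> \<psi>) \<in> T \<longleftrightarrow> \<^bold>\<not> \<phi> \<in> T \<and> \<^bold>\<not> \<psi> \<in> T" using *(13-15) by blast
  show "\<^bold>\<not> (\<phi> \<^bold>\<otimes> \<psi>) \<in> T \<longleftrightarrow> \<^bold>\<not> \<phi> \<in> T \<and> \<^bold>\<not> \<psi> \<in> T" using *(16-18) by blast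
  show "\<^bold>\<not> (\<phi> \<^bold>\<and> \<psi>) \<in> T \<longleftrightarrow> \<^bold>\<not> \<phi> \<in> T \<or> \<^bold>\<not> \<psi> \<in> T" using *(19-21) by blast
  show "\<^bold>\<not> (\<phi> \<^bold>\<oplus> \<psi>) \<in> T \<longleftrightarrow> \<^bold>\<not> \<phi> \<in> T \<or> \<^bold>\<not> \<psi> \<in> T" using *(22-24) by blast
  show "\<^bold>\<not> (\<^bold>\<not> \<phi>) \<in> T \<longleftrightarrow> \<phi> \<in> T" using nn by blast
qed

lemma prime_theory_combination:
  assumes "prime_theory S T"
  shows "combination Conj X \<phi> \<Longrightarrow> \<phi> \<in> T \<longleftrightarrow> X \<subseteq> T"
    and "combination Disj X \<phi> \<Longrightarrow> \<phi> \<in> T \<longleftrightarrow> X \<inter> T \<noteq> {}"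
  subgoal by (induction rule: combination.induct) (auto simp: prime_theory_iffs[OF assms])
  subgoal by (induction rule: combination.induct) (auto simp: prime_theory_iffs[OF assms])
  done


subsection \<open>Completeness\<close>

text \<open>
  The first component of a pair records evidence for, the second one evidence against.
\<close>

fun four_op :: "conn \<Rightarrow> bool \<times> bool \<Rightarrow> bool \<times> bool \<Rightarrow> bool \<times> bool" where
  "four_op Conj (a, a') (b, b') = (a \<and> b, a' \<or> b')"
| "four_op Disj (a, a') (b, b') = (a \<or> b, a' \<and> b')"
| "four_op Otimes (a, a') (b, b') = (a \<and> b, a' \<and> b')"
| "four_op Oplus (a, a') (b, b') = (a \<or> b, a' \<or> b')"

text \<open>The four-element bilattice is transported along an injection \<open>f\<close> because
  the countermodel must live in the given type \<open>'a\<close>.\<close>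

definition four_alg :: "(bool \<times> bool \<Rightarrow> 'a) \<Rightarrow> 'a alg" where
  "four_alg f = \<lparr>carrier = range f,
     binop = (\<lambda>c x y. f (four_op c (inv f x) (inv f y))),
     neg = (\<lambda>x. f (prod.swap (inv f x)))\<rparr>"

lemma four_alg_simps [simp]:
  assumes "inj f"
  shows "carrier (four_alg f) = range f"
    and "binop (four_alg f) c (f p) (f q) = f (four_op c p q)"
    and "neg (four_alg f) (f p) = f (prod.swap p)"
  using assms by (simp_all add: four_alg_def)

lemma four_alg_DBiLat:
  assumes "inj f"
  shows "four_alg f \<in> DBiLat"
proof -
  \<comment> \<open>Every operation acts as Boolean \<and> or \<or> in each coordinate, and each of
    these distributes over both.\<close>
  have distrib: "four_op c (a, a') (four_op d (b, b') (e, e')) =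
      four_op d (four_op c (a, a') (b, b')) (four_op c (a, a') (e, e'))"
    if "c \<noteq> d" for c d a a' b b' e e'
    using that by (cases c; cases d) auto
  have "bilattice (four_alg f)"
    unfolding bilattice_def closed_alg_def lattice_on_def le_t_def le_k_def
    by (auto simp: assms inj_eq)
  moreover have "distributive (four_alg f)"
    unfolding distributive_def by (auto simp: assms distrib)
  ultimately show ?thesis by (simp add: DBiLat_def)
qed

text \<open>The truth lemma: the clauses for compound formulas govern the first coordinate, those
  for their negations the second, and double negation matches the swap.\<close>

lemma eval_four_alg:
  assumes T: "prime_theory S T" and f: "inj f"
  shows "eval (four_alg f) (\<lambda>v. f (Var v \<in> T, \<^bold>\<not> (Var v) \<in> T)) \<phi> = f (\<phi> \<in> T, \<^bold>\<not> \<phi> \<in> T)"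
proof (induction \<phi>)
  case (Bin c \<phi> \<psi>)
  then show ?case by (cases c) (auto simp: f prime_theory_iffs[OF T])
qed (auto simp: f prime_theory_iffs[OF T])

lemma sat_tau_iff_seq_holds:
  assumes "combination_choice Conj bigconj" "combination_choice Disj bigdisj"
    and "B \<in> DBiLat" "range h \<subseteq> carrier B" "s \<in> sequents"
  shows "(\<forall>e\<in>tau bigconj bigdisj s. sat B h e) \<longleftrightarrow> distributive_bilattice.seq_holds B h s"
proof -
  interpret distributive_bilattice B by unfold_locales (rule assms)
  obtain \<Gamma> \<Delta> where s: "s = (\<Gamma> \<rhd> \<Delta>)" by (cases s)
  have "combination Conj \<Gamma> (bigconj \<Gamma>)" "combination Disj \<Delta> (bigdisj \<Delta>)"
    using assms by (auto simp: s sequents_def combination_choice_def)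
  then show ?thesis
    using assms(4) by (simp add: s seq_holds_combination tau_def sat_def ent_def)
qed

text \<open>In the second coordinate the equation is an instance of absorption and always holds; in
  the first it says that \<open>bigconj \<Gamma> \<in> T\<close> implies
  \<open>bigdisj \<Delta> \<in> T\<close>.\<close>

lemma sat_tau_four_alg:
  assumes "combination_choice Conj bigconj" "combination_choice Disj bigdisj"
    and T: "prime_theory S T" and f: "inj f" and s: "(\<Gamma> \<rhd> \<Delta>) \<in> sequents"
  shows "(\<forall>e\<in>tau bigconj bigdisj (\<Gamma> \<rhd> \<Delta>).
      sat (four_alg f) (\<lambda>v. f (Var v \<in> T, \<^bold>\<not> (Var v) \<in> T)) e) \<longleftrightarrow> (\<Gamma> \<subseteq> T \<longrightarrow> \<Delta> \<inter> T \<noteq> {})"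
proof -
  have "combination Conj \<Gamma> (bigconj \<Gamma>)" "combination Disj \<Delta> (bigdisj \<Delta>)"
    using assms(1,2) s by (simp_all add: sequents_def combination_choice_def)
  then have "bigconj \<Gamma> \<in> T \<longleftrightarrow> \<Gamma> \<subseteq> T" "bigdisj \<Delta> \<in> T \<longleftrightarrow> \<Delta> \<inter> T \<noteq> {}"
    by (simp_all add: prime_theory_combination[OF T])
  moreover have "(\<forall>e\<in>tau bigconj bigdisj (\<Gamma> \<rhd> \<Delta>).
      sat (four_alg f) (\<lambda>v. f (Var v \<in> T, \<^bold>\<not> (Var v) \<in> T)) e) \<longleftrightarrow>
      (bigconj \<Gamma> \<in> T \<longrightarrow> bigdisj \<Delta> \<in> T)"
    by (auto simp: tau_def sat_def eval_four_alg[OF T f] f inj_eq[OF f])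
  ultimately show ?thesis by simp
qed

lemma derivable_iff_eq_conseq:
  fixes bigconj bigdisj :: "'v fm set \<Rightarrow> 'v fm"
  assumes inf: "infinite (UNIV :: 'a set)"
    and choice: "combination_choice Conj bigconj" "combination_choice Disj bigdisj"
    and S: "S \<subseteq> sequents" and s: "s \<in> sequents"
  shows "derivable S s \<longleftrightarrow>
    eq_conseq (DBiLat :: 'a alg set) (\<Union>s'\<in>S. tau bigconj bigdisj s') (tau bigconj bigdisj s)"
    (is "_ \<longleftrightarrow> ?conseq")
proof
  assume d: "derivable S s"
  have "sat B h e"
    if B: "B \<in> DBiLat" and h: "range h \<subseteq> carrier B" and e: "e \<in> tau bigconj bigdisj s"
      and prem: "\<forall>e'\<in>(\<Union>s'\<in>S. tau bigconj bigdisj s'). sat B h e'" for B :: "'a alg" and h e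
  proof -
    interpret distributive_bilattice B by unfold_locales (rule B)
    note iff = sat_tau_iff_seq_holds[OF choice B h]
    have "\<forall>s'\<in>S. seq_holds h s'"
      using prem S iff by blast
    then show ?thesis
      using derivable_sound[OF d h] iff[OF s] e by blast
  qed
  then show ?conseq by (auto simp: eq_conseq_def)
next
  assume conseq: ?conseq
  show "derivable S s"
  proof (rule ccontr)
    assume nd: "\<not> derivable S s"
    obtain \<Gamma> \<Delta> where eq: "s = (\<Gamma> \<rhd> \<Delta>)" by (cases s)
    obtain T where T: "prime_theory S T" "\<Gamma> \<subseteq> T" "\<Delta> \<inter> T = {}"
      using prime_theory_exists[OF S] s nd unfolding eq by metis
    \<comment> \<open>An infinite type has room for four distinct elements.\<close>
    obtain f :: "bool \<times> bool \<Rightarrow> 'a" where f: "inj f"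
    proof -
      obtain X :: "'a set" where "finite X" "card X = card (UNIV :: (bool \<times> bool) set)"
        using infinite_arbitrarily_large[OF inf] by blast
      then obtain f :: "bool \<times> bool \<Rightarrow> 'a" where "bij_betw f UNIV X"
        using finite_same_card_bij[of "UNIV :: (bool \<times> bool) set" X] by auto
      then show ?thesis using that bij_betw_imp_inj_on by blast
    qed
    let ?h = "\<lambda>v. f (Var v \<in> T, \<^bold>\<not> (Var v) \<in> T)"
    note iff = sat_tau_four_alg[OF choice T(1) f]
    have prem: "\<forall>e'\<in>tau bigconj bigdisj s'. sat (four_alg f) ?h e'" if "s' \<in> S" for s'
    proof -
      obtain \<Gamma>' \<Delta>' where s': "s' = (\<Gamma>' \<rhd> \<Delta>')" by (cases s')
      \<comment> \<open>Members of \<open>S\<close> are derivable from \<open>S\<close>, so the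
        prime theory respects them.\<close>
      have "\<Gamma>' \<subseteq> T \<longrightarrow> \<Delta>' \<inter> T \<noteq> {}"
        using T(1) Hyp[OF that] unfolding s' prime_theory_def by blast
      moreover have "(\<Gamma>' \<rhd> \<Delta>') \<in> sequents" using S that s' by auto
      ultimately show ?thesis using iff s' by simp
    qed
    have range: "range ?h \<subseteq> carrier (four_alg f)" using f by auto
    have "sat (four_alg f) ?h e" if "e \<in> tau bigconj bigdisj s" for e
      using conseq[unfolded eq_conseq_def, rule_format, OF that four_alg_DBiLat[OF f] range] prem
      by blast
    then have "\<forall>e\<in>tau bigconj bigdisj s. sat (four_alg f) ?h e" ..
    then show False using iff[of \<Gamma> \<Delta>] s T eq by simp
  qed
qed

section \<open>Singleton sequents and the translation \<open>rho\<close>\<close>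

lemma combination_singleton:
  assumes "combination c {\<phi>} \<psi>"
  shows "\<psi> = \<phi>"
proof -
  have ne: "X \<noteq> {}" if "combination c X \<chi>" for X and \<chi> :: "'a fm"
    using that by induction auto
  show ?thesis
    using assms
  proof cases
    case (join X \<chi> Y \<xi>)
    \<comment> \<open>Two non-empty sets with union \<open>{\<phi>}\<close> both equal it, so they
      cannot be disjoint.\<close>
    have "X = {\<phi>}" "Y = {\<phi>}"
      using join(1) ne[OF join(3)] ne[OF join(4)] by (metis Un_singleton_iff)+
    with join(5) show ?thesis by simp
  qed simp
qed

lemma tau_rho:
  assumes "combination_choice Conj bigconj" "combination_choice Disj bigdisj"
  shows "(\<Union>s\<in>rho (\<phi> \<^bold>\<approx> \<psi>). tau bigconj bigdisj s) =
    (\<lambda>(\<alpha>, \<beta>). \<alpha> \<^bold>\<and> (\<alpha> \<^bold>\<otimes> \<beta>) \<^bold>\<approx> \<alpha>) ` {(\<phi>, \<psi>), (\<^bold>\<not> \<phi>, \<^bold>\<not> \<psi>), (\<psi>, \<phi>), (\<^bold>\<not> \<psi>, \<^bold>\<not> \<phi>)}"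
proof -
  have "bigconj {\<chi>} = \<chi>" "bigdisj {\<chi>} = \<chi>" for \<chi>
    using assms combination_singleton[of _ \<chi>] unfolding combination_choice_def
    by (metis finite.emptyI finite.insertI insert_not_empty)+
  then show ?thesis by (simp add: rho_def tau_def insert_commute)
qed

theorem theorem3p5p1:
  fixes bigconj bigdisj :: "('v :: countable) fm set \<Rightarrow> 'v fm"
  assumes "infinite (UNIV :: 'a set)"
    and "combination_choice Conj bigconj"
    and "combination_choice Disj bigdisj"
  shows "algebraizable (derivable :: 'v seq set \<Rightarrow> 'v seq \<Rightarrow> bool) (DBiLat :: 'a alg set)
           (tau bigconj bigdisj) rho"
proof -
  \<comment> \<open>Interderivability holds valuation by valuation: the four equations say that the
    two values, and their negations, entail each other, and \<open>ent_neg_antisym\<close> makes the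
    values equal.\<close>
  have "sat B h e \<longleftrightarrow> (\<forall>e'\<in>(\<Union>s\<in>rho e. tau bigconj bigdisj s). sat B h e')"
    if B: "B \<in> DBiLat" and h: "range h \<subseteq> carrier B" for B :: "'a alg" and h and e :: "'v eqn"
  proof -
    interpret distributive_bilattice B by unfold_locales (rule B)
    obtain \<phi> \<psi> where e: "e = (\<phi> \<^bold>\<approx> \<psi>)" by (cases e)
    show ?thesis
      using ent_neg_antisym[of "eval B h \<phi>" "eval B h \<psi>"] h
      by (auto simp: e tau_rho[OF assms(2,3)] sat_def ent_def)
  qed
  then have "eq_conseq (DBiLat :: 'a alg set) {e} (\<Union>s\<in>rho e. tau bigconj bigdisj s) \<and>
      eq_conseq (DBiLat :: 'a alg set) (\<Union>s\<in>rho e. tau bigconj bigdisj s) {e}" for e :: "'v eqn"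
    unfolding eq_conseq_def by blast
  moreover have "finite (tau bigconj bigdisj s)" for s
    by (cases s) (simp add: tau_def)
  moreover have "finite (rho e) \<and> rho e \<subseteq> sequents" for e :: "'v eqn"
    by (cases e) (simp add: rho_def sequents_def)
  ultimately show ?thesis
    unfolding algebraizable_def
    using derivable_iff_eq_conseq[OF assms] by blast
qed

end
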